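(* Let $n\ge2$, let $0<\beta<\beta'<1$, let $Y$ be a random vector in $\mathbb{R}^n$ whose support is not contained in a single line, and let $\Xi_1,\Xi_2,\ldots\subset S^{n-1}$ be an equidistributed sequence of sets, where $\Xi_k$ has cardinality $k$. Then $$\lim_{k\to\infty}\hat\delta_1^Y(\beta;\Xi_k)=\delta_1^Y(\beta),\qquad \lim_{k\to\infty}\hat\delta_2^Y(\beta;\Xi_k)=\delta_2^Y(\beta).$$ If there exists $\xi\in S^{n-1}$ with $q^Y(\beta\xi)\neq q^Y(-\beta\xi)$, then $$\lim_{k\to\infty}\hat\gamma_1^Y(\beta;\Xi_k)=\gamma_1^Y(\beta),\qquad \lim_{k\to\infty}\hat\gamma_2^Y(\beta;\Xi_k)=\gamma_2^Y(\beta),$$ $$\lim_{k\to\infty}\hat\kappa_1^Y(\beta,\beta';\Xi_k)=\kappa_1^Y(\beta,\beta'),\qquad \lim_{k\to\infty}\hat\kappa_2^Y(\beta,\beta';\Xi_k)=\kappa_2^Y(\beta,\beta').$$ If $q^Y(\beta\xi)\neq m^Y$ for all $\xi\in S^{n-1}$, then $$\lim_{k\to\infty}\hat\alpha^Y(\beta;\Xi_k)=\alpha^Y(\beta).$$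
   Context: Let $\lVert\cdot\rVert$ and $\langle\cdot,\cdot\rangle$ be the Euclidean norm and inner product on $\mathbb{R}^n$, $B_1^n(0)$ the open unit ball centered at $0$, and $S^{n-1}$ the unit sphere. Geometric quantiles: for a random vector $X$ in $\mathbb{R}^n$ and $u\in B_1^n(0)$, the $u$-quantile of $X$ is the value of $p\in\mathbb{R}^n$ minimizing $E[\lVert X-p\rVert+\langle u,X-p\rangle]$; to avoid any moment condition this is understood as minimizing $E\big[\lVert X-p\rVert-\lVert X\rVert-\langle u,p\rangle\big]$, which differs from the former by a constant not depending on $p$ when $E\lVert X\rVert<\infty$. It is known that if $n\ge2$ and the support of $X$ is not contained in a single line, then the $u$-quantile exists and is unique for every $u\in B_1^n(0)$, and the map $q^X:B_1^n(0)\to\mathbb{R}^n$ sending $u$ to the $u$-quantile of $X$ is continuous. Put $m^X:=q^X(0)$. For such $X$ and $0<\beta<\beta'<1$, with $d\xi$ the standard surface measure on $S^{n-1}$ and $SA(n-1)$ the surface area of $S^{n-1}$, define $$\delta_1^X(\beta):=\sup_{\xi\in S^{n-1}}\lVert q^X(\beta\xi)-q^X(-\beta\xi)\rVert,\qquad \delta_2^X(\beta):=\frac{1}{SA(n-1)}\int_{S^{n-1}}\lVert q^X(\beta\xi)-q^X(-\beta\xi)\rVert\,d\xi,$$ $$\gamma_1^X(\beta):=\frac{\sup_{\xi\in S^{n-1}}\lVert q^X(\beta\xi)+q^X(-\beta\xi)-2m^X\rVert}{\delta_1^X(\beta)}\in\mathbb{R},\qquad \gamma_2^X(\beta):=\frac{\frac{1}{SA(n-1)}\int_{S^{n-1}}(q^X(\beta\xi)-m^X)\,d\xi}{\delta_2^X(\beta)}\in\mathbb{R}^n,$$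 $$\kappa_1^X(\beta,\beta'):=\frac{\delta_1^X(\beta')}{\delta_1^X(\beta)},\qquad \kappa_2^X(\beta,\beta'):=\frac{\delta_2^X(\beta')}{\delta_2^X(\beta)},\qquad \alpha^X(\beta):=\log\left(\frac{\sup_{\xi\in S^{n-1}}\lVert q^X(\beta\xi)-m^X\rVert}{\inf_{\xi\in S^{n-1}}\lVert q^X(\beta\xi)-m^X\rVert}\right).$$ The quantities $\gamma_1^X,\gamma_2^X,\kappa_1^X,\kappa_2^X$ are well defined if and only if $q^X(\beta\xi)\ne q^X(-\beta\xi)$ for some $\xi\in S^{n-1}$, and $\alpha^X(\beta)$ is well defined in $\mathbb{R}$ if and only if $q^X(\beta\xi)\neq m^X$ for all $\xi\in S^{n-1}$. For a set $\Xi_k\subset S^{n-1}$ of cardinality $k$, define the approximations $$\hat\delta_1^X(\beta;\Xi_k):=\max_{\xi\in\Xi_k}\lVert q^X(\beta\xi)-q^X(-\beta\xi)\rVert,\qquad \hat\delta_2^X(\beta;\Xi_k):=\frac1k\sum_{\xi\in\Xi_k}\lVert q^X(\beta\xi)-q^X(-\beta\xi)\rVert,$$ $$\hat\gamma_1^X(\beta;\Xi_k):=\frac{\max_{\xi\in\Xi_k}\lVert q^X(\beta\xi)+q^X(-\beta\xi)-2m^X\rVert}{\hat\delta_1^X(\beta;\Xi_k)},\qquad \hat\gamma_2^X(\beta;\Xi_k):=\frac{\frac1k\sum_{\xi\in\Xi_k}(q^X(\beta\xi)-m^X)}{\hat\delta_2^X(\beta;\Xi_k)},$$ $$\hat\kappa_1^X(\beta,\beta';\Xi_k):=\frac{\hat\delta_1^X(\beta';\Xi_k)}{\hat\delta_1^X(\beta;\Xi_k)},\qquad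 \hat\kappa_2^X(\beta,\beta';\Xi_k):=\frac{\hat\delta_2^X(\beta';\Xi_k)}{\hat\delta_2^X(\beta;\Xi_k)},\qquad \hat\alpha^X(\beta;\Xi_k):=\log\left(\frac{\max_{\xi\in\Xi_k}\lVert q^X(\beta\xi)-m^X\rVert}{\min_{\xi\in\Xi_k}\lVert q^X(\beta\xi)-m^X\rVert}\right).$$ In limits as $k\to\infty$, quotients need only be defined for all sufficiently large $k$. Let $\mu_k$ be the empirical measure of $\Xi_k$, i.e. the probability measure assigning mass $1/k$ to each point of $\Xi_k$, and let $\mu$ be the uniform probability measure on $S^{n-1}$ (normalized surface measure). The sequence $\Xi_1,\Xi_2,\ldots$ is called equidistributed if $\mu_k$ converges weakly to $\mu$ as $k\to\infty$. *)

theory Defs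
  imports "HOL-Probability.Probability"
begin

section \<open>Support of a measure and weak convergence\<close>

definition measure_supp :: "'a::topological_space measure \<Rightarrow> 'a set" where
  "measure_supp N = {x. \<forall>U. open U \<longrightarrow> x \<in> U \<longrightarrow> emeasure N U > 0}"

text \<open>The measures are meant to be Borel measures whose space is the topological space \<open>S\<close>.\<close>

definition weakly_converges_on ::
    "'a::topological_space set \<Rightarrow> (nat \<Rightarrow> 'a measure) \<Rightarrow> 'a measure \<Rightarrow> bool" where
  "weakly_converges_on S N L \<longleftrightarrow>
    (\<forall>f :: 'a \<Rightarrow> real. continuous_on S f \<longrightarrow> bounded (f ` S) \<longrightarrow>
       (\<lambda>k. \<integral>x. f x \<partial>N k) \<longlonglongrightarrow> (\<integral>x. f x \<partial>L))"


section \<open>The unit sphere\<close>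

text \<open>Surface measure on the unit sphere of \<open>n\<close>-dimensional space, via polar coordinates:
  the measure of a Borel set \<open>A\<close> is \<open>n\<close> times the Lebesgue measure of
  \<open>{r * \<xi> | 0 < r < 1, \<xi> \<in> A}\<close>. In particular the total mass is \<open>n\<close> times the volume of the
  unit ball.\<close>

definition sphere_measure :: "(real^'n) measure" where
  "sphere_measure =
     scale_measure (of_nat CARD('n))
       (distr (restrict_space lborel (ball 0 1 - {0})) (restrict_space borel (sphere 0 1))
          (\<lambda>x. x /\<^sub>R norm x))"

definition sphere_area :: "'n::finite itself \<Rightarrow> real" where
  "sphere_area _ = measure (sphere_measure :: (real^'n) measure) (sphere 0 1)"

definition uniform_sphere :: "(real^'n) measure" where
  "uniform_sphere = uniform_measure sphere_measure (sphere 0 1)"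

definition empirical_measure :: "(real^'n) set \<Rightarrow> (real^'n) measure" where
  "empirical_measure \<Xi> =
     distr (uniform_count_measure \<Xi>) (restrict_space borel (sphere 0 1)) (\<lambda>\<xi>. \<xi>)"

definition equidistributed :: "(nat \<Rightarrow> (real^'n) set) \<Rightarrow> bool" where
  "equidistributed \<Xi> \<longleftrightarrow>
     weakly_converges_on (sphere 0 1) (\<lambda>k. empirical_measure (\<Xi> k)) uniform_sphere"


section \<open>Geometric quantiles\<close>

text \<open>The integrand is bounded (by \<open>(1 + norm u) * norm p\<close>), so no moment condition on \<open>X\<close>
  is needed.\<close>

definition quantile_objective ::
    "'w measure \<Rightarrow> ('w \<Rightarrow> real^'n) \<Rightarrow> real^'n \<Rightarrow> real^'n \<Rightarrow> real" where
  "quantile_objective M X u p = (\<integral>\<omega>. norm (X \<omega> - p) - norm (X \<omega>) - u \<bullet> p \<partial>M)"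

definition quantile :: "'w measure \<Rightarrow> ('w \<Rightarrow> real^'n) \<Rightarrow> real^'n \<Rightarrow> real^'n" where
  "quantile M X u = (THE p. is_arg_min (quantile_objective M X u) (\<lambda>_. True) p)"

definition geo_median :: "'w measure \<Rightarrow> ('w \<Rightarrow> real^'n) \<Rightarrow> real^'n" where
  "geo_median M X = quantile M X 0"


section \<open>Quantile-based measures of spread, skewness, kurtosis and asymmetry\<close>

definition delta1 :: "'w measure \<Rightarrow> ('w \<Rightarrow> real^'n) \<Rightarrow> real \<Rightarrow> real" where
  "delta1 M X \<beta> =
     (SUP \<xi>\<in>sphere 0 1. norm (quantile M X (\<beta> *\<^sub>R \<xi>) - quantile M X (- \<beta> *\<^sub>R \<xi>)))"

definition delta2 :: "'w measure \<Rightarrow> ('w \<Rightarrow> real^'n) \<Rightarrow> real \<Rightarrow> real" where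
  "delta2 M X \<beta> = 1 / sphere_area TYPE('n) *
     (\<integral>\<xi>. norm (quantile M X (\<beta> *\<^sub>R \<xi>) - quantile M X (- \<beta> *\<^sub>R \<xi>)) \<partial>sphere_measure)"

definition gamma1 :: "'w measure \<Rightarrow> ('w \<Rightarrow> real^'n) \<Rightarrow> real \<Rightarrow> real" where
  "gamma1 M X \<beta> =
     (SUP \<xi>\<in>sphere 0 1.
        norm (quantile M X (\<beta> *\<^sub>R \<xi>) + quantile M X (- \<beta> *\<^sub>R \<xi>) - 2 *\<^sub>R geo_median M X))
     / delta1 M X \<beta>"

definition gamma2 :: "'w measure \<Rightarrow> ('w \<Rightarrow> real^'n) \<Rightarrow> real \<Rightarrow> real^'n" where
  "gamma2 M X \<beta> =
     ((1 / sphere_area TYPE('n)) *\<^sub>R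
        (\<integral>\<xi>. quantile M X (\<beta> *\<^sub>R \<xi>) - geo_median M X \<partial>sphere_measure))
     /\<^sub>R delta2 M X \<beta>"

definition kappa1 :: "'w measure \<Rightarrow> ('w \<Rightarrow> real^'n) \<Rightarrow> real \<Rightarrow> real \<Rightarrow> real" where
  "kappa1 M X \<beta> \<beta>' = delta1 M X \<beta>' / delta1 M X \<beta>"

definition kappa2 :: "'w measure \<Rightarrow> ('w \<Rightarrow> real^'n) \<Rightarrow> real \<Rightarrow> real \<Rightarrow> real" where
  "kappa2 M X \<beta> \<beta>' = delta2 M X \<beta>' / delta2 M X \<beta>"

definition alpha :: "'w measure \<Rightarrow> ('w \<Rightarrow> real^'n) \<Rightarrow> real \<Rightarrow> real" where
  "alpha M X \<beta> =
     ln ((SUP \<xi>\<in>sphere 0 1. norm (quantile M X (\<beta> *\<^sub>R \<xi>) - geo_median M X)) /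
         (INF \<xi>\<in>sphere 0 1. norm (quantile M X (\<beta> *\<^sub>R \<xi>) - geo_median M X)))"


section \<open>Approximations from a finite set of directions\<close>

definition delta1_hat ::
    "'w measure \<Rightarrow> ('w \<Rightarrow> real^'n) \<Rightarrow> real \<Rightarrow> (real^'n) set \<Rightarrow> real" where
  "delta1_hat M X \<beta> \<Xi> =
     Max ((\<lambda>\<xi>. norm (quantile M X (\<beta> *\<^sub>R \<xi>) - quantile M X (- \<beta> *\<^sub>R \<xi>))) ` \<Xi>)"

definition delta2_hat ::
    "'w measure \<Rightarrow> ('w \<Rightarrow> real^'n) \<Rightarrow> real \<Rightarrow> (real^'n) set \<Rightarrow> real" where
  "delta2_hat M X \<beta> \<Xi> = 1 / real (card \<Xi>) *
     (\<Sum>\<xi>\<in>\<Xi>. norm (quantile M X (\<beta> *\<^sub>R \<xi>) - quantile M X (- \<beta> *\<^sub>R \<xi>)))"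

definition gamma1_hat ::
    "'w measure \<Rightarrow> ('w \<Rightarrow> real^'n) \<Rightarrow> real \<Rightarrow> (real^'n) set \<Rightarrow> real" where
  "gamma1_hat M X \<beta> \<Xi> =
     Max ((\<lambda>\<xi>. norm (quantile M X (\<beta> *\<^sub>R \<xi>) + quantile M X (- \<beta> *\<^sub>R \<xi>)
                      - 2 *\<^sub>R geo_median M X)) ` \<Xi>)
     / delta1_hat M X \<beta> \<Xi>"

definition gamma2_hat ::
    "'w measure \<Rightarrow> ('w \<Rightarrow> real^'n) \<Rightarrow> real \<Rightarrow> (real^'n) set \<Rightarrow> real^'n" where
  "gamma2_hat M X \<beta> \<Xi> =
     ((1 / real (card \<Xi>)) *\<^sub>R (\<Sum>\<xi>\<in>\<Xi>. quantile M X (\<beta> *\<^sub>R \<xi>) - geo_median M X))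
     /\<^sub>R delta2_hat M X \<beta> \<Xi>"

definition kappa1_hat ::
    "'w measure \<Rightarrow> ('w \<Rightarrow> real^'n) \<Rightarrow> real \<Rightarrow> real \<Rightarrow> (real^'n) set \<Rightarrow> real" where
  "kappa1_hat M X \<beta> \<beta>' \<Xi> = delta1_hat M X \<beta>' \<Xi> / delta1_hat M X \<beta> \<Xi>"

definition kappa2_hat ::
    "'w measure \<Rightarrow> ('w \<Rightarrow> real^'n) \<Rightarrow> real \<Rightarrow> real \<Rightarrow> (real^'n) set \<Rightarrow> real" where
  "kappa2_hat M X \<beta> \<beta>' \<Xi> = delta2_hat M X \<beta>' \<Xi> / delta2_hat M X \<beta> \<Xi>"

definition alpha_hat ::
    "'w measure \<Rightarrow> ('w \<Rightarrow> real^'n) \<Rightarrow> real \<Rightarrow> (real^'n) set \<Rightarrow> real" where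
  "alpha_hat M X \<beta> \<Xi> =
     ln (Max ((\<lambda>\<xi>. norm (quantile M X (\<beta> *\<^sub>R \<xi>) - geo_median M X)) ` \<Xi>) /
         Min ((\<lambda>\<xi>. norm (quantile M X (\<beta> *\<^sub>R \<xi>) - geo_median M X)) ` \<Xi>))"

end

theory Submission
  imports Defs
begin

text \<open>
  Everything rests on two facts: the quantile map is continuous on closed balls of radius less
  than one, and averages and maxima of a continuous function over equidistributed point sets
  converge to its spherical mean and its supremum.

  For the quantile map, the objective is \<open>excess p - u \<bullet> p\<close>, where \<open>excess p\<close> is the
  expectation of \<open>norm (Y - p) - norm Y\<close>. Equality in the triangle inequality at the midpoint of
  \<open>p\<close> and \<open>q\<close> forces \<open>Y\<close> onto the line through them, so a distribution whose support is not
  collinear makes \<open>excess\<close> strictly midpoint convex (\<open>excess_midpoint_less\<close>), and a minimizer is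
  unique. Since \<open>excess p\<close> is at least \<open>c * norm p\<close> up to a constant for each \<open>c < 1\<close>
  (\<open>excess_linear_growth\<close>), the minimizers for all \<open>u\<close> with \<open>norm u \<le> b < 1\<close> lie in one common
  compact ball, which gives existence. Minimality is a closed condition on the pair of \<open>u\<close> and its
  quantile, so the quantile map has a closed graph in a compact set and is continuous
  (\<open>continuous_on_quantile\<close>).

  On the sphere, weak convergence is tested against a continuous function directly, which yields
  convergence of averages (\<open>average_tendsto\<close>). For maxima, the surface measure charges each
  nonempty relatively open set, so such a set eventually contains one of the directions: the
  averages of a bump function that vanishes off the set converge to a positive number
  (\<open>eventually_directions_meet\<close>). Hence the maxima come arbitrarily close to the supremum.

  The theorem follows by applying these limits to \<open>\<xi> \<mapsto> quantile M Y (\<beta> *\<^sub>R \<xi>)\<close> and its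
  companions. The quotients and the logarithm are continuous at the limits because a spread that is
  positive in a single direction has positive supremum and positive mean, and because a positive
  continuous function on the compact sphere is bounded away from zero.
\<close>

section \<open>Geometric quantiles of a non-collinear distribution\<close>

text \<open>The equality case of the triangle inequality for \<open>y - p\<close> and \<open>y - q\<close>: the two vectors are
  parallel, and solving the proportionality for \<open>y\<close> writes it as an affine combination.\<close>

lemma midpoint_equality_imp_in_line:
  fixes p q y :: "'a::real_inner"
  assumes "p \<noteq> q" and eq: "norm ((y - p) + (y - q)) = norm (y - p) + norm (y - q)"
  shows "y \<in> affine hull {p, q}"
proof -
  define a b where "a = norm (y - p)" and "b = norm (y - q)"
  have ab: "a *\<^sub>R (y - q) = b *\<^sub>R (y - p)"
    using eq unfolding a_def b_def by (simp only: norm_triangle_eq)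
  show ?thesis
  proof (cases "a = b")
    case True
    then have "a = 0" using ab \<open>p \<noteq> q\<close> by auto
    then show ?thesis by (simp add: a_def hull_inc)
  next
    case False
    have "(a - b) *\<^sub>R y = a *\<^sub>R q - b *\<^sub>R p"
      using ab by (simp add: algebra_simps)
    then have "y = inverse (a - b) *\<^sub>R (a *\<^sub>R q - b *\<^sub>R p)"
      using False by (metis eq_iff_diff_eq_0 scaleR_scaleR left_inverse scaleR_one)
    also have "\<dots> = (- b / (a - b)) *\<^sub>R p + (a / (a - b)) *\<^sub>R q"
      by (simp add: algebra_simps divide_inverse)
    finally have "y = (- b / (a - b)) *\<^sub>R p + (a / (a - b)) *\<^sub>R q" .
    moreover have "- b / (a - b) + a / (a - b) = 1"
      unfolding add_divide_distrib[symmetric] using False by simp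
    ultimately show ?thesis unfolding affine_hull_2 by blast
  qed
qed

locale noncollinear_random_vector = prob_space M
  for M :: "'w measure" +
  fixes Y :: "'w \<Rightarrow> real^'n"
  assumes measurable_Y [measurable]: "Y \<in> borel_measurable M"
    and noncollinear: "\<not> collinear (measure_supp (distr M borel Y))"
begin

text \<open>The part of the objective that does not depend on \<open>u\<close>. Subtracting \<open>norm (Y \<omega>)\<close> inside the
  expectation bounds the integrand by \<open>norm p\<close>.\<close>

definition excess :: "real^'n \<Rightarrow> real" where
  "excess p = (\<integral>\<omega>. norm (Y \<omega> - p) - norm (Y \<omega>) \<partial>M)"

lemma integrable_excess: "integrable M (\<lambda>\<omega>. norm (Y \<omega> - p) - norm (Y \<omega>))"
proof (rule integrable_const_bound[where B = "norm p"])
  show "AE \<omega> in M. norm (norm (Y \<omega> - p) - norm (Y \<omega>)) \<le> norm p"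
  proof (intro AE_I2)
    fix \<omega>
    show "norm (norm (Y \<omega> - p) - norm (Y \<omega>)) \<le> norm p"
      using norm_triangle_ineq3[of "Y \<omega> - p" "Y \<omega>"] by simp
  qed
qed measurable

lemma quantile_objective_eq: "quantile_objective M Y u p = excess p - u \<bullet> p"
  unfolding quantile_objective_def excess_def
  using integrable_excess[of p] by (simp add: prob_space)

lemma excess_zero: "excess 0 = 0"
  by (simp add: excess_def)

lemma excess_diff_le: "excess p - excess p' \<le> norm (p - p')"
proof -
  have "excess p - excess p' =
      (\<integral>\<omega>. (norm (Y \<omega> - p) - norm (Y \<omega>)) - (norm (Y \<omega> - p') - norm (Y \<omega>)) \<partial>M)"
    unfolding excess_def
    by (rule Bochner_Integration.integral_diff[symmetric]) (rule integrable_excess)+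
  also have "\<dots> \<le> (\<integral>\<omega>. norm (p - p') \<partial>M)"
  proof (rule integral_mono)
    fix \<omega>
    show "norm (Y \<omega> - p) - norm (Y \<omega>) - (norm (Y \<omega> - p') - norm (Y \<omega>)) \<le> norm (p - p')"
      using norm_triangle_ineq[of "Y \<omega> - p'" "p' - p"] by (simp add: norm_minus_commute)
  qed (intro Bochner_Integration.integrable_diff integrable_excess, simp)
  finally show ?thesis by (simp add: prob_space)
qed

lemma continuous_on_excess: "continuous_on S excess"
proof -
  have "1-lipschitz_on S excess"
  proof (rule lipschitz_onI)
    fix p p'
    show "dist (excess p) (excess p') \<le> 1 * dist p p'"
      using excess_diff_le[of p p'] excess_diff_le[of p' p]
      by (simp add: dist_norm norm_minus_commute abs_le_iff)
  qed simp
  then show ?thesis by (rule lipschitz_on_continuous_on)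
qed

text \<open>A line is closed, so if it had full probability, its complement would be an open null set and
  the support would lie in the line.\<close>

lemma not_AE_in_line: "\<not> (AE \<omega> in M. Y \<omega> \<in> affine hull {p, q})"
proof
  assume *: "AE \<omega> in M. Y \<omega> \<in> affine hull {p, q}"
  have "measure_supp (distr M borel Y) \<subseteq> affine hull {p, q}"
  proof
    fix x assume x: "x \<in> measure_supp (distr M borel Y)"
    show "x \<in> affine hull {p, q}"
    proof (rule ccontr)
      let ?U = "- (affine hull {p, q})"
      assume "x \<notin> affine hull {p, q}"
      moreover have op: "open ?U"
        using closed_affine_hull[of "{p, q}"] by (simp add: open_closed)
      ultimately have "emeasure (distr M borel Y) ?U > 0"
        using x by (auto simp: measure_supp_def)
      moreover have "emeasure (distr M borel Y) ?U = emeasure M {\<omega> \<in> space M. Y \<omega> \<in> ?U}"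
        using op by (subst emeasure_distr) (auto intro!: arg_cong[where f = "emeasure M"])
      moreover have "emeasure M {\<omega> \<in> space M. Y \<omega> \<in> ?U} = 0"
        by (rule emeasure_eq_0_AE) (use * in simp)
      ultimately show False by simp
    qed
  qed
  then show False
    using noncollinear collinear_affine_hull by blast
qed

text \<open>Strict convexity: the pointwise deficit \<open>D\<close> in the triangle inequality is nonnegative, and its
  expectation vanishes only if \<open>Y\<close> lies on the line through \<open>p\<close> and \<open>q\<close> almost surely.\<close>

lemma excess_midpoint_less:
  assumes "p \<noteq> q"
  shows "2 * excess (midpoint p q) < excess p + excess q"
proof -
  define D where "D \<omega> = (norm (Y \<omega> - p) - norm (Y \<omega>)) + (norm (Y \<omega> - q) - norm (Y \<omega>))
     - 2 * (norm (Y \<omega> - midpoint p q) - norm (Y \<omega>))" for \<omega>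
  have D: "D \<omega> = norm (Y \<omega> - p) + norm (Y \<omega> - q) - norm ((Y \<omega> - p) + (Y \<omega> - q))" for \<omega>
  proof -
    have "(Y \<omega> - p) + (Y \<omega> - q) = 2 *\<^sub>R (Y \<omega> - midpoint p q)"
      by (simp add: midpoint_def algebra_simps scaleR_2)
    then have "norm ((Y \<omega> - p) + (Y \<omega> - q)) = 2 * norm (Y \<omega> - midpoint p q)" by simp
    then show ?thesis unfolding D_def by simp
  qed
  define h where "h p \<omega> = norm (Y \<omega> - p) - norm (Y \<omega>)" for p \<omega>
  have h: "integrable M (h p)" "integral\<^sup>L M (h p) = excess p" for p
    unfolding h_def by (simp_all only: integrable_excess excess_def)
  have D_h: "D = (\<lambda>\<omega>. h p \<omega> + h q \<omega> - 2 * h (midpoint p q) \<omega>)"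
    unfolding D_def h_def ..
  have intD: "integrable M D"
    unfolding D_h by (intro Bochner_Integration.integrable_add Bochner_Integration.integrable_diff
        integrable_mult_right h)
  have E: "integral\<^sup>L M D = excess p + excess q - 2 * excess (midpoint p q)"
    unfolding D_h using h by simp
  have nonneg: "0 \<le> D \<omega>" for \<omega>
    using norm_triangle_ineq[of "Y \<omega> - p" "Y \<omega> - q"] by (simp add: D)
  have "integral\<^sup>L M D \<noteq> 0"
  proof
    assume "integral\<^sup>L M D = 0"
    then have "AE \<omega> in M. D \<omega> = 0"
      using integral_nonneg_eq_0_iff_AE[OF intD] nonneg by simp
    then have "AE \<omega> in M. Y \<omega> \<in> affine hull {p, q}"
      by eventually_elim (rule midpoint_equality_imp_in_line[OF assms], simp add: D)
    then show False using not_AE_in_line by blast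
  qed
  moreover have "0 \<le> integral\<^sup>L M D"
    using nonneg by simp
  ultimately show ?thesis using E by linarith
qed

text \<open>The integrand is at least \<open>norm p - 2 * n\<close> where \<open>norm (Y \<omega>) \<le> n\<close>, and never less than
  \<open>- norm p\<close>. Choosing \<open>n\<close> so large that \<open>norm (Y \<omega>) > n\<close> has small probability makes the slope
  as close to one as desired.\<close>

lemma excess_linear_growth:
  assumes "c < 1"
  shows "\<exists>R. \<forall>p. c * norm p - R \<le> excess p"
proof -
  define A where "A n = {\<omega> \<in> space M. real n < norm (Y \<omega>)}" for n
  have A_sets [measurable]: "A n \<in> sets M" for n
    unfolding A_def by measurable
  have "(\<lambda>n. prob (A n)) \<longlonglongrightarrow> prob (\<Inter>n. A n)"
    by (rule finite_Lim_measure_decseq) (use A_sets in \<open>auto simp: A_def decseq_def\<close>)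
  moreover have "(\<Inter>n. A n) = {}"
    by (auto simp: A_def) (meson less_asym reals_Archimedean2)
  ultimately have "(\<lambda>n. prob (A n)) \<longlonglongrightarrow> 0" by simp
  then have "eventually (\<lambda>n. prob (A n) < (1 - c) / 2) sequentially"
    by (rule order_tendstoD) (use assms in simp)
  then obtain n where n: "prob (A n) < (1 - c) / 2"
    by (auto simp: eventually_sequentially)
  have "c * norm p - 2 * real n \<le> excess p" for p
  proof -
    have "c * norm p - 2 * real n \<le> norm p * (1 - 2 * prob (A n)) - 2 * real n"
      using mult_left_mono[of c "1 - 2 * prob (A n)" "norm p"] n by (simp add: mult.commute)
    also have "\<dots> = (\<integral>\<omega>. norm p * (1 - 2 * indicator (A n) \<omega>) - 2 * real n \<partial>M)"
      by (simp add: prob_space algebra_simps emeasure_eq_measure)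
    also have "\<dots> \<le> excess p"
      unfolding excess_def
    proof (rule integral_mono)
      fix \<omega> assume "\<omega> \<in> space M"
      then show "norm p * (1 - 2 * indicator (A n) \<omega>) - 2 * real n \<le> norm (Y \<omega> - p) - norm (Y \<omega>)"
        using norm_triangle_ineq2[of p "Y \<omega>"] norm_triangle_ineq2[of "Y \<omega>" p]
          norm_triangle_ineq2[of "Y \<omega>" "Y \<omega> - p"]
        by (auto simp: A_def indicator_def norm_minus_commute)
    qed (auto simp: emeasure_eq_measure intro: integrable_excess)
    finally show ?thesis .
  qed
  then show ?thesis by blast
qed

text \<open>The level zero is the value of the objective at the origin, so each minimizer lies in this
  sublevel set. The radius is uniform in \<open>u\<close>, as the compactness argument for continuity demands.\<close>

lemma objective_sublevel_bounded:
  assumes "b < 1"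
  shows "\<exists>\<rho>\<ge>0. \<forall>u p. norm u \<le> b \<longrightarrow> excess p - u \<bullet> p \<le> 0 \<longrightarrow> norm p \<le> \<rho>"
proof -
  \<comment> \<open>A growth rate halfway between \<open>b\<close> and one leaves a surplus of \<open>(1 - b) / 2\<close> over \<open>u \<bullet> p\<close>.\<close>
  obtain R where R: "\<And>p. (1 + b) / 2 * norm p - R \<le> excess p"
    using excess_linear_growth[of "(1 + b) / 2"] assms by auto
  show ?thesis
  proof (intro exI[of _ "max 0 (2 * R / (1 - b))"] conjI allI impI)
    fix u p :: "real^'n"
    assume u: "norm u \<le> b" and p: "excess p - u \<bullet> p \<le> 0"
    have "u \<bullet> p \<le> b * norm p"
      using norm_cauchy_schwarz[of u p] mult_right_mono[OF u, of "norm p"] by simp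
    then have "(1 - b) * norm p \<le> 2 * R"
      using R[of p] p by (simp add: field_simps)
    then have "norm p \<le> 2 * R / (1 - b)"
      using assms by (simp add: pos_le_divide_eq mult.commute)
    then show "norm p \<le> max 0 (2 * R / (1 - b))" by simp
  qed simp
qed

lemma quantile_exists:
  assumes "norm u < 1"
  shows "\<exists>p. \<forall>p'. excess p - u \<bullet> p \<le> excess p' - u \<bullet> p'"
proof -
  obtain \<rho> where \<rho>: "\<rho> \<ge> 0" "\<And>p. excess p - u \<bullet> p \<le> 0 \<Longrightarrow> norm p \<le> \<rho>"
    using objective_sublevel_bounded[OF assms] by blast
  have "continuous_on (cball 0 \<rho>) (\<lambda>p. excess p - u \<bullet> p)"
    by (intro continuous_intros continuous_on_excess)
  then obtain p where p: "p \<in> cball 0 \<rho>"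
    "\<And>p'. p' \<in> cball 0 \<rho> \<Longrightarrow> excess p - u \<bullet> p \<le> excess p' - u \<bullet> p'"
    using continuous_attains_inf[of "cball 0 \<rho>" "\<lambda>p. excess p - u \<bullet> p"] \<rho>(1)
    by (auto simp del: mem_cball)
  have "excess p - u \<bullet> p \<le> excess p' - u \<bullet> p'" for p'
  proof (cases "p' \<in> cball 0 \<rho>")
    case False
    then have "excess p' - u \<bullet> p' > 0" using \<rho>(2)[of p'] by force
    moreover have "excess p - u \<bullet> p \<le> 0"
      using p(2)[of 0] \<rho>(1) by (simp add: excess_zero)
    ultimately show ?thesis by simp
  qed (use p in blast)
  then show ?thesis by blast
qed

lemma quantile_unique:
  assumes "\<And>p'. excess p - u \<bullet> p \<le> excess p' - u \<bullet> p'"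
    and "\<And>p'. excess q - u \<bullet> q \<le> excess p' - u \<bullet> p'"
  shows "p = q"
proof (rule ccontr)
  assume "p \<noteq> q"
  define F where "F p = excess p - u \<bullet> p" for p
  have "2 * F (midpoint p q) < F p + F q"
    using excess_midpoint_less[OF \<open>p \<noteq> q\<close>]
    by (simp add: F_def midpoint_def inner_add_right field_simps)
  moreover have "F p \<le> F (midpoint p q)" "F q \<le> F (midpoint p q)"
    unfolding F_def by (rule assms)+
  ultimately show False by linarith
qed

lemma quantile_eq_iff:
  assumes "norm u < 1"
  shows "quantile M Y u = p \<longleftrightarrow> (\<forall>p'. excess p - u \<bullet> p \<le> excess p' - u \<bullet> p')"
proof -
  have arg: "is_arg_min (quantile_objective M Y u) (\<lambda>_. True) p \<longleftrightarrow>
      (\<forall>p'. excess p - u \<bullet> p \<le> excess p' - u \<bullet> p')" for p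
    by (auto simp: is_arg_min_def quantile_objective_eq not_less)
  obtain q where q: "\<forall>p'. excess q - u \<bullet> q \<le> excess p' - u \<bullet> p'"
    using quantile_exists[OF assms] by blast
  have "quantile M Y u = q"
    unfolding quantile_def arg using q by (intro the_equality) (auto intro: quantile_unique)
  then show ?thesis using q quantile_unique by blast
qed

text \<open>The graph is the set of pairs \<open>(u, p)\<close> satisfying all the inequalities that make \<open>p\<close> a
  minimizer. Each is a closed condition, and the values lie in a compact ball.\<close>

lemma continuous_on_quantile:
  assumes "b < 1"
  shows "continuous_on (cball 0 b) (quantile M Y)"
proof -
  obtain \<rho> where \<rho>: "\<And>u p. norm u \<le> b \<Longrightarrow> excess p - u \<bullet> p \<le> 0 \<Longrightarrow> norm p \<le> \<rho>"
    using objective_sublevel_bounded[OF assms] by blast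
  have min: "excess (quantile M Y u) - u \<bullet> quantile M Y u \<le> excess p' - u \<bullet> p'"
    if "u \<in> cball 0 b" for u p'
    using quantile_eq_iff[of u "quantile M Y u"] that assms by simp
  show ?thesis
  proof (rule continuous_from_closed_graph)
    show "compact (cball (0 :: real^'n) \<rho>)" by simp
    show "quantile M Y \<in> cball 0 b \<rightarrow> cball 0 \<rho>"
    proof
      fix u :: "real^'n" assume u: "u \<in> cball 0 b"
      show "quantile M Y u \<in> cball 0 \<rho>"
        using \<rho>[of u] u min[OF u, of 0] by (simp add: excess_zero)
    qed
    have "(\<lambda>u. (u, quantile M Y u)) ` cball 0 b =
        (cball 0 b \<times> UNIV) \<inter>
        (\<Inter>p'. {z. excess (snd z) - fst z \<bullet> snd z \<le> excess p' - fst z \<bullet> p'})" (is "?G = ?C")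
    proof (intro set_eqI iffI)
      fix z assume "z \<in> ?G"
      then show "z \<in> ?C" using min by auto
    next
      fix z assume z: "z \<in> ?C"
      then have "quantile M Y (fst z) = snd z"
        using quantile_eq_iff[of "fst z" "snd z"] assms by auto
      then have "z = (fst z, quantile M Y (fst z))" by simp
      moreover have "fst z \<in> cball 0 b" using z by auto
      ultimately show "z \<in> ?G" by (rule image_eqI)
    qed
    moreover have "closed ?C"
      by (intro closed_Int closed_Times closed_INT ballI closed_Collect_le continuous_intros
          continuous_on_compose2[OF continuous_on_excess]) auto
    ultimately show "closed ?G" by simp
  qed
qed

end

section \<open>Surface measure on the sphere\<close>

lemma radial_projection_measurable:
  "(\<lambda>x. x /\<^sub>R norm x) \<in> restrict_space lborel (ball (0 :: real^'n) 1 - {0}) \<rightarrow>\<^sub>M restrict_space borel (sphere 0 1)"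
  by (intro measurable_restrict_space3) auto

lemma space_sphere_measure: "space (sphere_measure :: (real^'n) measure) = sphere 0 1"
  by (simp add: sphere_measure_def space_scale_measure space_restrict_space)

lemma emeasure_sphere_measure:
  fixes A :: "(real^'n) set"
  assumes "A \<in> sets (restrict_space borel (sphere 0 1))"
  shows "emeasure sphere_measure A =
    of_nat CARD('n) * emeasure lborel {x \<in> ball 0 1 - {0}. x /\<^sub>R norm x \<in> A}"
proof -
  have "emeasure (distr (restrict_space lborel (ball 0 1 - {0})) (restrict_space borel (sphere 0 1))
          (\<lambda>x. x /\<^sub>R norm x)) A = emeasure (restrict_space lborel (ball 0 1 - {0}))
          ((\<lambda>x. x /\<^sub>R norm x) -` A \<inter> space (restrict_space lborel (ball 0 1 - {0})))"
    using radial_projection_measurable assms by (rule emeasure_distr)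
  also have "\<dots> = emeasure lborel ((\<lambda>x. x /\<^sub>R norm x) -` A \<inter> space (restrict_space lborel (ball 0 1 - {0})))"
    by (rule emeasure_restrict_space) (auto simp: space_restrict_space)
  also have "(\<lambda>x. x /\<^sub>R norm x) -` A \<inter> space (restrict_space lborel (ball 0 1 - {0})) =
     {x \<in> ball 0 1 - {0}. x /\<^sub>R norm x \<in> A}"
    by (auto simp: space_restrict_space)
  finally show ?thesis by (simp add: sphere_measure_def)
qed

lemma emeasure_lborel_open_pos:
  fixes U :: "'a::euclidean_space set"
  assumes "open U" "x \<in> U"
  shows "emeasure lborel U > 0"
proof -
  obtain e where "e > 0" "ball x e \<subseteq> U" using assms open_contains_ball by blast
  then have "0 < emeasure lborel (ball x e)"
    using content_ball_pos[of e x] by (simp add: measure_def enn2real_positive_iff)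
  also have "\<dots> \<le> emeasure lborel U" using \<open>ball x e \<subseteq> U\<close> assms(1) by (intro emeasure_mono) auto
  finally show ?thesis .
qed

text \<open>The surface measure charges each nonempty relatively open superlevel set, because the open
  cone over such a set contains a small ball.\<close>

lemma sphere_measure_full_support:
  fixes f :: "real^'n \<Rightarrow> real"
  assumes f: "continuous_on (sphere 0 1) f" and "\<xi> \<in> sphere 0 1" "c < f \<xi>"
  shows "0 < emeasure sphere_measure {\<xi> \<in> sphere 0 1. c < f \<xi>}"
proof -
  let ?A = "{\<xi> \<in> sphere 0 1. c < f \<xi>}"
  have A: "?A \<in> sets (restrict_space borel (sphere 0 1))"
  proof -
    have [measurable]: "f \<in> borel_measurable (restrict_space borel (sphere 0 1))"
      using f by (rule borel_measurable_continuous_on_restrict)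
    have "{\<xi> \<in> space (restrict_space borel (sphere 0 1)). c < f \<xi>} \<in> sets (restrict_space borel (sphere 0 1))"
      by measurable
    then show ?thesis by (simp add: space_restrict_space)
  qed
  let ?U = "{x \<in> ball 0 1 - {0}. x /\<^sub>R norm x \<in> ?A}"
  have "?U = {x \<in> ball 0 1 - {0}. c < f (x /\<^sub>R norm x)}"
    by auto
  moreover have "open {x \<in> ball 0 1 - {0}. c < f (x /\<^sub>R norm x)}"
  proof -
    have "continuous_on (ball 0 1 - {0}) (\<lambda>x. f (x /\<^sub>R norm x))"
    proof (rule continuous_on_compose2[OF f])
      show "continuous_on (ball 0 1 - {0}) (\<lambda>x. x /\<^sub>R norm x)"
        by (intro continuous_intros) auto
      have "x /\<^sub>R norm x \<in> sphere 0 1" if "x \<noteq> 0" for x :: "real^'n"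
        using that by simp
      then show "(\<lambda>x. x /\<^sub>R norm x) ` (ball 0 1 - {0}) \<subseteq> sphere (0 :: real^'n) 1"
        by blast
    qed
    then have "open ((ball 0 1 - {0}) \<inter> (\<lambda>x. f (x /\<^sub>R norm x)) -` {c<..})"
      by (rule continuous_open_preimage) (auto intro: open_delete)
    also have "(ball 0 1 - {0}) \<inter> (\<lambda>x. f (x /\<^sub>R norm x)) -` {c<..} =
        {x \<in> ball 0 1 - {0}. c < f (x /\<^sub>R norm x)}"
      by auto
    finally show ?thesis .
  qed
  ultimately have "open ?U" by simp
  moreover have "(1/2) *\<^sub>R \<xi> \<in> ?U" using assms by auto
  ultimately have "0 < emeasure lborel ?U" by (rule emeasure_lborel_open_pos)
  then show ?thesis
    unfolding emeasure_sphere_measure[OF A] by (simp add: ennreal_zero_less_mult_iff)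
qed

lemma finite_measure_sphere_measure: "finite_measure (sphere_measure :: (real^'n) measure)"
proof
  have "sphere 0 1 \<in> sets (restrict_space borel (sphere (0 :: real^'n) 1))"
    using sets.top[of "restrict_space borel (sphere (0 :: real^'n) 1)"]
    by (simp only: space_restrict_space space_borel Int_UNIV_right)
  then have "emeasure (sphere_measure :: (real^'n) measure) (sphere 0 1) \<le>
    of_nat CARD('n) * emeasure lborel (ball (0 :: real^'n) 1)"
    unfolding emeasure_sphere_measure[OF \<open>sphere 0 1 \<in> _\<close>]
    by (intro mult_left_mono emeasure_mono) auto
  also have "\<dots> < \<infinity>"
    using emeasure_lborel_ball_finite[of "0 :: real^'n" 1] by (simp add: ennreal_mult_less_top of_nat_less_top)
  finally show "emeasure (sphere_measure :: (real^'n) measure) (space sphere_measure) \<noteq> \<infinity>"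
    by (simp add: space_sphere_measure)
qed

lemma sphere_area_pos: "0 < sphere_area TYPE('n::finite)"
proof -
  interpret finite_measure "sphere_measure :: (real^'n) measure"
    by (rule finite_measure_sphere_measure)
  have "axis (undefined :: 'n) (1 :: real) \<in> sphere 0 1" by simp
  then have "0 < emeasure (sphere_measure :: (real^'n) measure) {\<xi> \<in> sphere 0 1. 0 < (1 :: real)}"
    by (intro sphere_measure_full_support[of _ "axis undefined 1"]) auto
  moreover have "{\<xi> \<in> sphere (0 :: real^'n) 1. 0 < (1 :: real)} = sphere 0 1" by auto
  ultimately show ?thesis by (simp only: sphere_area_def emeasure_eq_measure ennreal_less_zero_iff)
qed

lemma integrable_sphere:
  fixes f :: "real^'n \<Rightarrow> 'b::{banach, second_countable_topology}"
  assumes f: "continuous_on (sphere 0 1) f"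
  shows "integrable sphere_measure f"
proof -
  interpret finite_measure "sphere_measure :: (real^'n) measure"
    by (rule finite_measure_sphere_measure)
  have "bounded (f ` sphere 0 1)"
    by (intro compact_imp_bounded compact_continuous_image f) auto
  then obtain B where B: "\<And>\<xi>. \<xi> \<in> sphere 0 1 \<Longrightarrow> norm (f \<xi>) \<le> B"
    unfolding bounded_iff by blast
  show ?thesis
  proof (rule integrable_const_bound[where B = B])
    show "AE \<xi> in sphere_measure. norm (f \<xi>) \<le> B"
      using B by (intro AE_I2) (simp add: space_sphere_measure)
    show "f \<in> borel_measurable sphere_measure"
      using borel_measurable_continuous_on_restrict[OF f]
      by (simp cong: measurable_cong_sets add: sphere_measure_def)
  qed
qed

lemma integral_uniform_sphere:
  fixes f :: "real^'n \<Rightarrow> real"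
  assumes f: "continuous_on (sphere 0 1) f"
  shows "integral\<^sup>L uniform_sphere f = 1 / sphere_area TYPE('n) * integral\<^sup>L sphere_measure f"
proof -
  interpret finite_measure "sphere_measure :: (real^'n) measure"
    by (rule finite_measure_sphere_measure)
  have fm: "f \<in> borel_measurable sphere_measure"
    using integrable_sphere[OF f] by (rule borel_measurable_integrable)
  have density: "uniform_sphere = density sphere_measure (\<lambda>_::real^'n. ennreal (1 / sphere_area TYPE('n)))"
    unfolding uniform_sphere_def uniform_measure_def
  proof (rule density_cong)
    show "AE \<xi> in sphere_measure. indicator (sphere 0 1) \<xi> / emeasure sphere_measure (sphere (0 :: real^'n) 1)
        = ennreal (1 / sphere_area TYPE('n))"
      using sphere_area_pos[where 'n = 'n]
      by (intro AE_I2)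
        (simp add: space_sphere_measure emeasure_eq_measure sphere_area_def divide_ennreal ennreal_1[symmetric] del: ennreal_1)
  next
    have "sphere 0 1 \<in> sets (sphere_measure :: (real^'n) measure)"
      using sets.top[of "sphere_measure :: (real^'n) measure"] by (simp only: space_sphere_measure)
    then show "(\<lambda>x :: real^'n. indicator (sphere 0 1) x / emeasure sphere_measure (sphere (0 :: real^'n) 1))
        \<in> borel_measurable sphere_measure"
      by (intro borel_measurable_divide_ennreal borel_measurable_indicator borel_measurable_const)
  qed simp
  have "integral\<^sup>L uniform_sphere f =
      (\<integral>\<xi>. (1 / sphere_area TYPE('n)) *\<^sub>R f \<xi> \<partial>sphere_measure)"
    unfolding density using fm sphere_area_pos[where 'n = 'n]
    by (intro integral_density) (auto intro: less_imp_le)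
  then show ?thesis by simp
qed

lemma integral_empirical_measure:
  fixes f :: "real^'n \<Rightarrow> real"
  assumes f: "continuous_on (sphere 0 1) f" and A: "A \<subseteq> sphere 0 1" "finite A"
  shows "integral\<^sup>L (empirical_measure A) f = 1 / real (card A) * (\<Sum>\<xi>\<in>A. f \<xi>)"
proof -
  have "integral\<^sup>L (empirical_measure A) f = integral\<^sup>L (uniform_count_measure A) f"
    unfolding empirical_measure_def
  proof (rule integral_distr)
    show "(\<lambda>\<xi>. \<xi>) \<in> uniform_count_measure A \<rightarrow>\<^sub>M restrict_space borel (sphere 0 1)"
      using A by (auto simp: measurable_def space_uniform_count_measure sets_uniform_count_measure space_restrict_space)
  qed (rule borel_measurable_continuous_on_restrict[OF f])
  then show ?thesis using A by (simp add: integral_uniform_count_measure)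
qed

lemma spherical_mean_pos:
  fixes f :: "real^'n \<Rightarrow> real"
  assumes f: "continuous_on (sphere 0 1) f" and nonneg: "\<And>\<xi>. \<xi> \<in> sphere 0 1 \<Longrightarrow> 0 \<le> f \<xi>"
    and "\<xi> \<in> sphere 0 1" "0 < f \<xi>"
  shows "0 < 1 / sphere_area TYPE('n) * integral\<^sup>L sphere_measure f"
proof -
  have AE: "AE \<xi> in sphere_measure. 0 \<le> f \<xi>"
    using nonneg by (intro AE_I2) (simp add: space_sphere_measure)
  have "integral\<^sup>L sphere_measure f \<noteq> 0"
  proof
    assume "integral\<^sup>L sphere_measure f = 0"
    then have "AE \<xi> in sphere_measure. f \<xi> = 0"
      using integral_nonneg_eq_0_iff_AE[OF integrable_sphere[OF f] AE] by simp
    then have "AE \<xi> in sphere_measure. \<not> 0 < f \<xi>"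
      by eventually_elim simp
    then have "emeasure sphere_measure {\<xi> \<in> space sphere_measure. 0 < f \<xi>} = 0"
      by (rule emeasure_eq_0_AE)
    then have "emeasure sphere_measure {\<xi> \<in> sphere 0 1. 0 < f \<xi>} = 0"
      by (simp only: space_sphere_measure)
    then show False
      using sphere_measure_full_support[OF f assms(3,4)] by (simp only: less_irrefl)
  qed
  moreover have "0 \<le> integral\<^sup>L sphere_measure f" using AE by (rule integral_nonneg_AE)
  ultimately show ?thesis using sphere_area_pos[where 'n = 'n] by simp
qed

lemma sphere_SUP_upper:
  fixes f :: "real^'n \<Rightarrow> real"
  assumes "continuous_on (sphere 0 1) f" "\<xi> \<in> sphere 0 1"
  shows "f \<xi> \<le> (SUP \<xi>\<in>sphere 0 1. f \<xi>)"
  by (intro cSUP_upper assms bounded_imp_bdd_above compact_imp_bounded compact_continuous_image) auto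

section \<open>Limits along equidistributed directions\<close>

locale equidistributed_directions =
  fixes \<Xi> :: "nat \<Rightarrow> (real^'n) set"
  assumes directions: "k \<ge> 1 \<Longrightarrow> \<Xi> k \<subseteq> sphere 0 1 \<and> card (\<Xi> k) = k"
    and equidistributed: "equidistributed \<Xi>"
begin

lemma finite_directions: "k \<ge> 1 \<Longrightarrow> finite (\<Xi> k)" and directions_nonempty: "k \<ge> 1 \<Longrightarrow> \<Xi> k \<noteq> {}"
  using directions[of k] by (auto intro: card_ge_0_finite)

lemma average_tendsto:
  fixes f :: "real^'n \<Rightarrow> real"
  assumes f: "continuous_on (sphere 0 1) f"
  shows "(\<lambda>k. 1 / real (card (\<Xi> k)) * (\<Sum>\<xi>\<in>\<Xi> k. f \<xi>)) \<longlonglongrightarrow>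
    1 / sphere_area TYPE('n) * integral\<^sup>L sphere_measure f"
proof -
  have "bounded (f ` sphere 0 1)"
    by (intro compact_imp_bounded compact_continuous_image f) auto
  then have "(\<lambda>k. integral\<^sup>L (empirical_measure (\<Xi> k)) f) \<longlonglongrightarrow> integral\<^sup>L uniform_sphere f"
    using equidistributed f unfolding equidistributed_def weakly_converges_on_def by blast
  moreover have "eventually (\<lambda>k. integral\<^sup>L (empirical_measure (\<Xi> k)) f =
      1 / real (card (\<Xi> k)) * (\<Sum>\<xi>\<in>\<Xi> k. f \<xi>)) sequentially"
    using eventually_ge_at_top[of 1]
    by eventually_elim (rule integral_empirical_measure[OF f], use directions finite_directions in auto)
  ultimately show ?thesis
    unfolding integral_uniform_sphere[OF f] by (rule Lim_transform_eventually)
qed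

text \<open>Weak convergence has real test functions, so the vector-valued case is read off from the
  components.\<close>

lemma average_tendsto_vec:
  fixes f :: "real^'n \<Rightarrow> real^'m"
  assumes f: "continuous_on (sphere 0 1) f"
  shows "(\<lambda>k. (1 / real (card (\<Xi> k))) *\<^sub>R (\<Sum>\<xi>\<in>\<Xi> k. f \<xi>)) \<longlonglongrightarrow>
    (1 / sphere_area TYPE('n)) *\<^sub>R integral\<^sup>L sphere_measure f"
proof (rule vec_tendstoI)
  fix i
  have "continuous_on (sphere 0 1) (\<lambda>\<xi>. f \<xi> $ i)"
    using f by (intro continuous_intros)
  from average_tendsto[OF this]
  show "(\<lambda>k. ((1 / real (card (\<Xi> k))) *\<^sub>R (\<Sum>\<xi>\<in>\<Xi> k. f \<xi>)) $ i) \<longlonglongrightarrow>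
    ((1 / sphere_area TYPE('n)) *\<^sub>R integral\<^sup>L sphere_measure f) $ i"
    using integral_bounded_linear[OF bounded_linear_vec_nth[of i] integrable_sphere[OF f]]
    by (simp add: sum_component)
qed

text \<open>Weak convergence concerns continuous test functions only, so the indicator of the superlevel
  set is replaced by the positive part \<open>g\<close> of \<open>f - c\<close>. Its spherical mean is positive, and an
  average of \<open>g\<close> over directions that all avoid the set would vanish.\<close>

lemma eventually_directions_meet:
  fixes f :: "real^'n \<Rightarrow> real"
  assumes f: "continuous_on (sphere 0 1) f" and "\<xi> \<in> sphere 0 1" "c < f \<xi>"
  shows "eventually (\<lambda>k. \<exists>\<xi>\<in>\<Xi> k. c < f \<xi>) sequentially"
proof -
  define g where "g \<xi> = max 0 (f \<xi> - c)" for \<xi>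
  have g: "continuous_on (sphere 0 1) g"
    unfolding g_def by (intro continuous_intros f)
  have "0 < 1 / sphere_area TYPE('n) * integral\<^sup>L sphere_measure g"
    by (rule spherical_mean_pos[OF g]) (use assms in \<open>auto simp: g_def\<close>)
  with average_tendsto[OF g]
  have "eventually (\<lambda>k. 0 < 1 / real (card (\<Xi> k)) * (\<Sum>\<xi>\<in>\<Xi> k. g \<xi>)) sequentially"
    by (rule order_tendstoD)
  then show ?thesis
  proof eventually_elim
    case (elim k)
    show ?case
    proof (rule ccontr)
      assume "\<not> (\<exists>\<xi>\<in>\<Xi> k. c < f \<xi>)"
      then have "(\<Sum>\<xi>\<in>\<Xi> k. g \<xi>) = 0"
        by (intro sum.neutral) (auto simp: g_def)
      then show False using elim by simp
    qed
  qed
qed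

lemma Max_tendsto:
  fixes f :: "real^'n \<Rightarrow> real"
  assumes f: "continuous_on (sphere 0 1) f"
  shows "(\<lambda>k. Max (f ` \<Xi> k)) \<longlonglongrightarrow> (SUP \<xi>\<in>sphere 0 1. f \<xi>)"
proof (rule order_tendstoI)
  have bdd: "bdd_above (f ` sphere 0 1)"
    by (intro bounded_imp_bdd_above compact_imp_bounded compact_continuous_image f) auto
  {
    fix c assume "c < (SUP \<xi>\<in>sphere 0 1. f \<xi>)"
    then obtain \<xi> where "\<xi> \<in> sphere 0 1" "c < f \<xi>"
      using less_cSUP_iff[OF _ bdd, of c] by auto
    from eventually_directions_meet[OF f this] eventually_ge_at_top[of 1]
    show "eventually (\<lambda>k. c < Max (f ` \<Xi> k)) sequentially"
      by eventually_elim (use finite_directions directions_nonempty in \<open>auto simp: Max_gr_iff\<close>)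
  next
    fix c assume c: "(SUP \<xi>\<in>sphere 0 1. f \<xi>) < c"
    show "eventually (\<lambda>k. Max (f ` \<Xi> k) < c) sequentially"
      using eventually_ge_at_top[of 1]
    proof eventually_elim
      case (elim k)
      have "f \<xi> < c" if "\<xi> \<in> \<Xi> k" for \<xi>
        using cSUP_upper[OF _ bdd, of \<xi>] that directions[OF elim] c by force
      then show ?case
        using finite_directions[OF elim] directions_nonempty[OF elim] by simp
    qed
  }
qed

lemma Min_tendsto:
  fixes f :: "real^'n \<Rightarrow> real"
  assumes f: "continuous_on (sphere 0 1) f"
  shows "(\<lambda>k. Min (f ` \<Xi> k)) \<longlonglongrightarrow> (INF \<xi>\<in>sphere 0 1. f \<xi>)"
proof -
  have "(\<lambda>k. - Max ((\<lambda>\<xi>. - f \<xi>) ` \<Xi> k)) \<longlonglongrightarrow> - (SUP \<xi>\<in>sphere 0 1. - f \<xi>)"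
    by (intro tendsto_minus Max_tendsto continuous_intros f)
  moreover have "eventually (\<lambda>k. - Max ((\<lambda>\<xi>. - f \<xi>) ` \<Xi> k) = Min (f ` \<Xi> k)) sequentially"
    using eventually_ge_at_top[of 1]
  proof eventually_elim
    case (elim k)
    have "- Max (uminus ` f ` \<Xi> k) = Min (f ` \<Xi> k)"
      using finite_directions[OF elim] directions_nonempty[OF elim]
        minus_Max_eq_Min[of "uminus ` f ` \<Xi> k"] by (simp add: image_image)
    then show ?case by (simp add: image_image)
  qed
  ultimately show ?thesis
    unfolding Inf_real_def image_image by (rule Lim_transform_eventually)
qed

end

section \<open>Consistency of the approximations\<close>

theorem proposition2p2:
  fixes M :: "'w measure" and Y :: "'w \<Rightarrow> real^'n"
    and \<beta> \<beta>' :: real and \<Xi> :: "nat \<Rightarrow> (real^'n) set"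
  assumes "CARD('n) \<ge> 2"
    and "0 < \<beta>" and "\<beta> < \<beta>'" and "\<beta>' < 1"
    and "prob_space M" and "Y \<in> borel_measurable M"
    and "\<not> collinear (measure_supp (distr M borel Y))"
    and "\<And>k. k \<ge> 1 \<Longrightarrow> \<Xi> k \<subseteq> sphere 0 1 \<and> card (\<Xi> k) = k"
    and "equidistributed \<Xi>"
  shows "((\<lambda>k. delta1_hat M Y \<beta> (\<Xi> k)) \<longlonglongrightarrow> delta1 M Y \<beta>) \<and>
         ((\<lambda>k. delta2_hat M Y \<beta> (\<Xi> k)) \<longlonglongrightarrow> delta2 M Y \<beta>) \<and>
         ((\<exists>\<xi>\<in>sphere 0 1. quantile M Y (\<beta> *\<^sub>R \<xi>) \<noteq> quantile M Y (- \<beta> *\<^sub>R \<xi>)) \<longrightarrow>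
            (\<forall>\<^sub>F k in sequentially. delta1_hat M Y \<beta> (\<Xi> k) \<noteq> 0 \<and> delta2_hat M Y \<beta> (\<Xi> k) \<noteq> 0) \<and>
            ((\<lambda>k. gamma1_hat M Y \<beta> (\<Xi> k)) \<longlonglongrightarrow> gamma1 M Y \<beta>) \<and>
            ((\<lambda>k. gamma2_hat M Y \<beta> (\<Xi> k)) \<longlonglongrightarrow> gamma2 M Y \<beta>) \<and>
            ((\<lambda>k. kappa1_hat M Y \<beta> \<beta>' (\<Xi> k)) \<longlonglongrightarrow> kappa1 M Y \<beta> \<beta>') \<and>
            ((\<lambda>k. kappa2_hat M Y \<beta> \<beta>' (\<Xi> k)) \<longlonglongrightarrow> kappa2 M Y \<beta> \<beta>')) \<and>
         ((\<forall>\<xi>\<in>sphere 0 1. quantile M Y (\<beta> *\<^sub>R \<xi>) \<noteq> geo_median M Y) \<longrightarrow>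
            ((\<lambda>k. alpha_hat M Y \<beta> (\<Xi> k)) \<longlonglongrightarrow> alpha M Y \<beta>))"
proof -
  interpret noncollinear_random_vector M Y
    using assms(5-7) by (simp add: noncollinear_random_vector_def noncollinear_random_vector_axioms_def)
  interpret equidistributed_directions \<Xi>
    using assms(8,9) by unfold_locales auto
  define m where "m = geo_median M Y"
  define q where "q b \<xi> = quantile M Y (b *\<^sub>R \<xi>)" for b \<xi>
  have q: "continuous_on (sphere 0 1) (q b)" if "\<bar>b\<bar> < 1" for b
    unfolding q_def
    by (rule continuous_on_compose2[OF continuous_on_quantile[OF that]])
      (auto intro!: continuous_intros)
  define spread where "spread b \<xi> = norm (q b \<xi> - q (- b) \<xi>)" for b \<xi>
  define skew where "skew \<xi> = norm (q \<beta> \<xi> + q (- \<beta>) \<xi> - 2 *\<^sub>R m)" for \<xi>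
  define deviation where "deviation \<xi> = norm (q \<beta> \<xi> - m)" for \<xi>
  have spread: "continuous_on (sphere 0 1) (spread b)" if "\<bar>b\<bar> < 1" for b
    unfolding spread_def using that by (intro continuous_intros q) auto
  have skew: "continuous_on (sphere 0 1) skew"
    unfolding skew_def using assms(2-4) by (intro continuous_intros q) auto
  have deviation: "continuous_on (sphere 0 1) deviation"
    unfolding deviation_def using assms(2-4) by (intro continuous_intros q) auto
  \<comment> \<open>These equations fold each defining expression back into the functions above.\<close>
  note fold = q_def[symmetric] m_def[symmetric] spread_def[symmetric] skew_def[symmetric]
    deviation_def[symmetric]

  have d1: "(\<lambda>k. delta1_hat M Y b (\<Xi> k)) \<longlonglongrightarrow> delta1 M Y b" if "\<bar>b\<bar> < 1" for b
    using Max_tendsto[OF spread[OF that]] by (simp only: delta1_hat_def delta1_def fold)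
  have d2: "(\<lambda>k. delta2_hat M Y b (\<Xi> k)) \<longlonglongrightarrow> delta2 M Y b" if "\<bar>b\<bar> < 1" for b
    using average_tendsto[OF spread[OF that]] by (simp only: delta2_hat_def delta2_def fold)
  have \<beta>: "\<bar>\<beta>\<bar> < 1" "\<bar>\<beta>'\<bar> < 1" using assms(2-4) by auto

  have quotients: "(\<forall>\<^sub>F k in sequentially. delta1_hat M Y \<beta> (\<Xi> k) \<noteq> 0 \<and> delta2_hat M Y \<beta> (\<Xi> k) \<noteq> 0) \<and>
            ((\<lambda>k. gamma1_hat M Y \<beta> (\<Xi> k)) \<longlonglongrightarrow> gamma1 M Y \<beta>) \<and>
            ((\<lambda>k. gamma2_hat M Y \<beta> (\<Xi> k)) \<longlonglongrightarrow> gamma2 M Y \<beta>) \<and>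
            ((\<lambda>k. kappa1_hat M Y \<beta> \<beta>' (\<Xi> k)) \<longlonglongrightarrow> kappa1 M Y \<beta> \<beta>') \<and>
            ((\<lambda>k. kappa2_hat M Y \<beta> \<beta>' (\<Xi> k)) \<longlonglongrightarrow> kappa2 M Y \<beta> \<beta>')"
    if ex: "\<exists>\<xi>\<in>sphere 0 1. quantile M Y (\<beta> *\<^sub>R \<xi>) \<noteq> quantile M Y (- \<beta> *\<^sub>R \<xi>)"
  proof -
    obtain \<xi> where \<xi>: "\<xi> \<in> sphere 0 1" "0 < spread \<beta> \<xi>"
      using ex unfolding spread_def q_def by auto
    have pos1: "0 < delta1 M Y \<beta>"
      using sphere_SUP_upper[OF spread[OF \<beta>(1)] \<xi>(1)] \<xi>(2) by (simp only: delta1_def fold)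
    have pos2: "0 < delta2 M Y \<beta>"
      using spherical_mean_pos[OF spread[OF \<beta>(1)] _ \<xi>] by (simp only: delta2_def fold) (simp add: spread_def)
    have nz1: "\<forall>\<^sub>F k in sequentially. delta1_hat M Y \<beta> (\<Xi> k) \<noteq> 0"
      using tendsto_imp_eventually_ne[OF d1[OF \<beta>(1)]] pos1 by simp
    have nz2: "\<forall>\<^sub>F k in sequentially. delta2_hat M Y \<beta> (\<Xi> k) \<noteq> 0"
      using tendsto_imp_eventually_ne[OF d2[OF \<beta>(1)]] pos2 by simp
    have "continuous_on (sphere 0 1) (\<lambda>\<xi>. q \<beta> \<xi> - m)"
      using \<beta> by (intro continuous_intros q)
    note average = average_tendsto_vec[OF this, unfolded q_def m_def]
    have g2: "(\<lambda>k. gamma2_hat M Y \<beta> (\<Xi> k)) \<longlonglongrightarrow> gamma2 M Y \<beta>"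
      unfolding gamma2_hat_def gamma2_def
      by (rule tendsto_scaleR[OF tendsto_inverse[OF d2[OF \<beta>(1)]] average]) (use pos2 in simp)
    have g1: "(\<lambda>k. gamma1_hat M Y \<beta> (\<Xi> k)) \<longlonglongrightarrow> gamma1 M Y \<beta>"
      using tendsto_divide[OF Max_tendsto[OF skew] d1[OF \<beta>(1)]] pos1
      by (simp only: gamma1_hat_def gamma1_def fold)
    have k1: "(\<lambda>k. kappa1_hat M Y \<beta> \<beta>' (\<Xi> k)) \<longlonglongrightarrow> kappa1 M Y \<beta> \<beta>'"
      unfolding kappa1_hat_def kappa1_def using pos1 by (intro tendsto_divide d1 \<beta>) auto
    have k2: "(\<lambda>k. kappa2_hat M Y \<beta> \<beta>' (\<Xi> k)) \<longlonglongrightarrow> kappa2 M Y \<beta> \<beta>'"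
      unfolding kappa2_hat_def kappa2_def using pos2 by (intro tendsto_divide d2 \<beta>) auto
    show ?thesis using eventually_conj[OF nz1 nz2] g1 g2 k1 k2 by blast
  qed

  have asymmetry: "(\<lambda>k. alpha_hat M Y \<beta> (\<Xi> k)) \<longlonglongrightarrow> alpha M Y \<beta>"
    if ne: "\<forall>\<xi>\<in>sphere 0 1. quantile M Y (\<beta> *\<^sub>R \<xi>) \<noteq> geo_median M Y"
  proof -
    have nonempty: "sphere (0 :: real^'n) 1 \<noteq> {}" by simp
    then obtain \<xi> where \<xi>: "\<xi> \<in> sphere 0 1" and min: "\<And>\<eta>. \<eta> \<in> sphere 0 1 \<Longrightarrow> deviation \<xi> \<le> deviation \<eta>"
      using continuous_attains_inf[OF _ nonempty deviation] by (metis compact_sphere)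
    have "0 < deviation \<xi>"
      using ne \<xi> unfolding deviation_def q_def m_def by simp
    moreover have "deviation \<xi> \<le> (INF \<xi>\<in>sphere 0 1. deviation \<xi>)"
      using min by (intro cINF_greatest nonempty)
    moreover have "deviation \<xi> \<le> (SUP \<xi>\<in>sphere 0 1. deviation \<xi>)"
      by (rule sphere_SUP_upper[OF deviation \<xi>])
    ultimately have pos: "0 < (INF \<xi>\<in>sphere 0 1. deviation \<xi>)" "0 < (SUP \<xi>\<in>sphere 0 1. deviation \<xi>)"
      by linarith+
    have "(\<lambda>k. ln (Max (deviation ` \<Xi> k) / Min (deviation ` \<Xi> k))) \<longlonglongrightarrow>
        ln ((SUP \<xi>\<in>sphere 0 1. deviation \<xi>) / (INF \<xi>\<in>sphere 0 1. deviation \<xi>))"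
      by (intro tendsto_ln tendsto_divide Max_tendsto Min_tendsto deviation) (use pos in auto)
    then show ?thesis by (simp only: alpha_hat_def alpha_def fold)
  qed
  show ?thesis
    using d1[OF \<beta>(1)] d2[OF \<beta>(1)] quotients asymmetry by blast
qed

end
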